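(* Let $(\mathcal X^n)_{n\ge 1}$ be a large market as described in the context, with numéraire portfolios $V^n\in\mathcal X^n_1$ and sets $\mathcal D^n$ of equivalent supermartingale densities. The following conditions are equivalent: (a) SAA (there exists a strong asymptotic arbitrage on $(\mathcal X^n)$); (b) there exists a sequence $Y^n\in\mathcal X^n_1$ such that $\limsup_{n\to\infty}\mathsf P^n(Y^n_T\ge M)=1$ for all $M>0$; (c) $\limsup_{n\to\infty}\mathsf P^n(V^n_T\ge M)=1$ for all $M>0$; (d) $(\mathsf P^n)\bigtriangleup ((V_T^n)^{-1}\cdot\mathsf P^n)$; (e) $(\mathsf P^n)\bigtriangleup (Z_T^n\cdot\mathsf P^n)$ for any sequence $Z^n\in\mathcal D^n$.
   Context: Setting. For each $n\ge1$, $(\Omega^n,\mathcal F^n_T,\mathsf P^n)$ is a probability space with a filtration $\mathbb F^n=(\mathcal F^n_t)_{t\in\mathbb T^n}$, where $\mathbb T^n$ is an interval $[0,T(n)]$ or a set of integers $\{0,\dots,T(n)\}$; the $\sigma$-algebra $\mathcal F^n_0$ is trivial up to $\mathsf P^n$-null sets. A subscript $T$ on an object of the $n$-th market means $T(n)$ (so $\mathcal F^n_T=\mathcal F^n_{T(n)}$, $X^n_T=X^n_{T(n)}$). $\mathcal X^n$ is a family of non-negative $\mathbb F^n$-adapted processes such that: (i) $1\in\mathcal X^n$, and $X\in\mathcal X^n$, $\lambda>0$ imply $\lambda X\in\mathcal X^n$; (ii) there is a strictly positive process (numéraire portfolio) $V^n\in\mathcal X^n_1=\{X^n\in\mathcal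 X^n: X^n_0=1\}$ such that $X^n/V^n$ is a $\mathsf P^n$-supermartingale for all $X^n\in\mathcal X^n$. The large market is the sequence $(\mathcal X^n)_{n\ge1}$. SAA (strong asymptotic arbitrage): there is a sequence $X^n\in\mathcal X^n$ with $X^n_0\to0$ and $\limsup_{n\to\infty}\mathsf P^n(X^n_T\ge1)=1$. $\mathcal D^n$ is the set of equivalent supermartingale densities: strictly positive $\mathbb F^n$-adapted processes $Z^n$ with $Z^n_0=1$ such that $X^nZ^n$ is a $\mathsf P^n$-supermartingale for all $X^n\in\mathcal X^n$. For a non-negative $\mathcal F^n_T$-measurable random variable $\xi^n$, $\xi^n\cdot\mathsf P^n$ is the measure $A\mapsto\mathsf E_{\mathsf P^n}(\xi^nI_A)$, $A\in\mathcal F^n_T$. The measures $Z^n_T\cdot\mathsf P^n$, $Z^n\in\mathcal D^n$, are sub-probability measures (countably additive with values in $[0,1]$). For probability measures $\mathsf P^n$ and sub-probability measures $\mathsf Q^n$ on $\mathcal F^n_T$: $(\mathsf P^n)\bigtriangleup(\mathsf Q^n)$ (entire separation) means that there exist natural numbers $n_k\uparrow\infty$ and sets $A^{n_k}\in\mathcal F^{n_k}_T$ with $\mathsf P^{n_k}(A^{n_k})\to1$ and $\mathsf Q^{n_k}(A^{n_k})\to0$ as $k\to\infty$. *)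

theory Defs
  imports "HOL-Probability.Probability"
begin

text \<open>
  Conventions. Time is real; a process is a function
  \<open>real \<Rightarrow> 'a \<Rightarrow> real\<close> of which only the values at times in the
  index set of the market matter. Equalities and inequalities between random variables at a
  fixed time (non-negativity, strict positivity, initial values) hold almost surely.
\<close>

definition adapted :: "real set \<Rightarrow> (real \<Rightarrow> 'a measure) \<Rightarrow> (real \<Rightarrow> 'a \<Rightarrow> real) \<Rightarrow> bool" where
  "adapted I F X \<longleftrightarrow> (\<forall>t\<in>I. X t \<in> borel_measurable (F t))"

definition supermartingale ::
  "'a measure \<Rightarrow> real set \<Rightarrow> (real \<Rightarrow> 'a measure) \<Rightarrow> (real \<Rightarrow> 'a \<Rightarrow> real) \<Rightarrow> bool" where
  "supermartingale P I F X \<longleftrightarrow>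
     adapted I F X \<and>
     (\<forall>t\<in>I. integrable P (X t)) \<and>
     (\<forall>s\<in>I. \<forall>t\<in>I. s \<le> t \<longrightarrow> (AE \<omega> in P. real_cond_exp P (F s) (X t) \<omega> \<le> X s \<omega>))"

definition filtration_on :: "'a measure \<Rightarrow> real set \<Rightarrow> (real \<Rightarrow> 'a measure) \<Rightarrow> bool" where
  "filtration_on P I F \<longleftrightarrow>
     (\<forall>t\<in>I. subalgebra P (F t)) \<and>
     (\<forall>s\<in>I. \<forall>t\<in>I. s \<le> t \<longrightarrow> sets (F s) \<subseteq> sets (F t))"

definition time_set :: "real set \<Rightarrow> real \<Rightarrow> bool" where
  "time_set I T \<longleftrightarrow>
     0 \<le> T \<and> (I = {0..T} \<or> (\<exists>N::nat. T = real N \<and> I = real ` {0..N}))"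

text \<open>
  In \<open>filt\<close> only the spaces and \<open>\<sigma>\<close>-algebras are relevant, not the measures carried by
  \<open>filt m t\<close>.
\<close>

record 'a market =
  Prob :: "'a measure"
  times :: "real set"
  horizon :: real
  filt :: "real \<Rightarrow> 'a measure"
  wealth :: "(real \<Rightarrow> 'a \<Rightarrow> real) set"

definition unit_wealth :: "'a market \<Rightarrow> (real \<Rightarrow> 'a \<Rightarrow> real) set" where
  "unit_wealth m = {X \<in> wealth m. AE \<omega> in Prob m. X 0 \<omega> = 1}"

definition numeraire_portfolio :: "'a market \<Rightarrow> (real \<Rightarrow> 'a \<Rightarrow> real) \<Rightarrow> bool" where
  "numeraire_portfolio m V \<longleftrightarrow>
     V \<in> unit_wealth m \<and>
     (\<forall>t\<in>times m. AE \<omega> in Prob m. 0 < V t \<omega>) \<and>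
     (\<forall>X\<in>wealth m. supermartingale (Prob m) (times m) (filt m) (\<lambda>t \<omega>. X t \<omega> / V t \<omega>))"

definition is_market :: "'a market \<Rightarrow> bool" where
  "is_market m \<longleftrightarrow>
     prob_space (Prob m) \<and>
     time_set (times m) (horizon m) \<and>
     filtration_on (Prob m) (times m) (filt m) \<and>
     sets (filt m (horizon m)) = sets (Prob m) \<and>
     (\<forall>A\<in>sets (filt m 0). measure (Prob m) A = 0 \<or> measure (Prob m) A = 1) \<and>
     (\<forall>X\<in>wealth m. adapted (times m) (filt m) X \<and>
                    (\<forall>t\<in>times m. AE \<omega> in Prob m. 0 \<le> X t \<omega>)) \<and>
     (\<lambda>t \<omega>. 1) \<in> wealth m \<and>
     (\<forall>X\<in>wealth m. \<forall>c>0. (\<lambda>t \<omega>. c * X t \<omega>) \<in> wealth m) \<and>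
     (\<exists>V. numeraire_portfolio m V)"

definition supermartingale_densities :: "'a market \<Rightarrow> (real \<Rightarrow> 'a \<Rightarrow> real) set" where
  "supermartingale_densities m =
     {Z. adapted (times m) (filt m) Z \<and>
         (\<forall>t\<in>times m. AE \<omega> in Prob m. 0 < Z t \<omega>) \<and>
         (AE \<omega> in Prob m. Z 0 \<omega> = 1) \<and>
         (\<forall>X\<in>wealth m. supermartingale (Prob m) (times m) (filt m) (\<lambda>t \<omega>. X t \<omega> * Z t \<omega>))}"

definition prob_ge :: "'a market \<Rightarrow> (real \<Rightarrow> 'a \<Rightarrow> real) \<Rightarrow> real \<Rightarrow> real" where
  "prob_ge m X c = measure (Prob m) {\<omega> \<in> space (Prob m). c \<le> X (horizon m) \<omega>}"

text \<open>
  The initial \<open>\<sigma>\<close>-algebra is trivial, so every \<open>X n 0\<close> is almost surely equal to a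
  constant \<open>x n\<close>; \<open>X\<^sub>0 \<rightarrow> 0\<close> means that these constants tend to 0.
\<close>

definition SAA :: "(nat \<Rightarrow> 'a market) \<Rightarrow> bool" where
  "SAA m \<longleftrightarrow>
     (\<exists>X x. (\<forall>n. X n \<in> wealth (m n)) \<and>
            (\<forall>n. AE \<omega> in Prob (m n). X n 0 \<omega> = x n) \<and>
            x \<longlonglongrightarrow> (0::real) \<and>
            limsup (\<lambda>n. ereal (prob_ge (m n) (X n) 1)) = 1)"

definition weighted_measure :: "('a \<Rightarrow> real) \<Rightarrow> 'a measure \<Rightarrow> 'a measure" where
  "weighted_measure \<xi> P = density P (\<lambda>\<omega>. ennreal (\<xi> \<omega>))"

definition entirely_separated :: "(nat \<Rightarrow> 'a measure) \<Rightarrow> (nat \<Rightarrow> 'a measure) \<Rightarrow> bool" where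
  "entirely_separated P Q \<longleftrightarrow>
     (\<exists>r A. strict_mono (r :: nat \<Rightarrow> nat) \<and>
            (\<forall>k. A k \<in> sets (P (r k))) \<and>
            (\<lambda>k. emeasure (P (r k)) (A k)) \<longlonglongrightarrow> 1 \<and>
            (\<lambda>k. emeasure (Q (r k)) (A k)) \<longlonglongrightarrow> 0)"

end

theory Submission imports Defs begin

text \<open>
  Everything rests on one inequality: a supermartingale has terminal expectation at most its
  initial value. It is applied to two processes.

  For a wealth process \<open>X\<close> with initial capital \<open>x\<close>, the supermartingale \<open>X / V\<close> satisfies
  \<open>E (X\<^sub>T / V\<^sub>T) \<le> x\<close>, so by Markov's inequality \<open>X\<^sub>T \<ge> 1\<close> forces \<open>V\<^sub>T \<ge> K\<close> outside a set of
  probability at most \<open>K x\<close>. Hence any strong asymptotic arbitrage makes the numeraire portfolio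
  explode, (a) to (c). Conversely, (c) gives (b) with \<open>Y = V\<close>, and an exploding sequence of
  portfolios with unit initial capital becomes a strong asymptotic arbitrage after division by
  constants \<open>c n\<close> which tend to infinity slowly enough, (b) to (a); a diagonal argument supplies
  them.

  For a supermartingale density \<open>Z\<close>, the supermartingale \<open>V Z\<close> satisfies \<open>E (V\<^sub>T Z\<^sub>T) \<le> 1\<close>, so
  \<open>Z\<^sub>T \<cdot> P\<close> gives mass at most \<open>1 / K\<close> to \<open>{V\<^sub>T \<ge> K}\<close>. If these events have almost full
  probability for large \<open>K\<close>, they separate \<open>P\<close> from \<open>Z\<^sub>T \<cdot> P\<close>, (c) to (e). Since \<open>1 / V\<close> is itself
  such a density, (e) yields (d). Finally, on \<open>{V\<^sub>T < M}\<close> the measure \<open>P\<close> is dominated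
  by \<open>M\<close> times \<open>V\<^sub>T\<inverse> \<cdot> P\<close>, so any event separating these measures lies, up to small
  probability, in \<open>{V\<^sub>T \<ge> M}\<close>, (d) to (c).
\<close>

section \<open>Upper limits equal to one\<close>

lemma limsup_eq_oneI:
  fixes f :: "nat \<Rightarrow> real"
  assumes "\<And>n. f n \<le> 1" and "strict_mono r" and "(\<lambda>k. f (r k)) \<longlonglongrightarrow> 1"
  shows "limsup (\<lambda>n. ereal (f n)) = 1"
proof (rule antisym)
  show "limsup (\<lambda>n. ereal (f n)) \<le> 1"
    by (rule Limsup_bounded) (simp add: assms(1))
  have "(\<lambda>k. ereal (f (r k))) \<longlonglongrightarrow> 1"
    using assms(3) by (simp add: one_ereal_def)
  then have "limsup ((\<lambda>n. ereal (f n)) \<circ> r) = 1"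
    by (simp add: lim_imp_Limsup comp_def)
  then show "1 \<le> limsup (\<lambda>n. ereal (f n))"
    using limsup_subseq_mono[OF assms(2), of "\<lambda>n. ereal (f n)"] by simp
qed

lemma limsup_eq_oneE:
  fixes f :: "nat \<Rightarrow> real"
  assumes "limsup (\<lambda>n. ereal (f n)) = 1"
  obtains r where "strict_mono r" and "(\<lambda>k. f (r k)) \<longlonglongrightarrow> 1"
proof -
  obtain r where "strict_mono r" and "((\<lambda>n. ereal (f n)) \<circ> r) \<longlonglongrightarrow> 1"
    using limsup_subseq_lim[of "\<lambda>n. ereal (f n)"] assms by metis
  then show thesis
    by (intro that[of r]) (simp_all add: comp_def one_ereal_def)
qed

text \<open>
  For each fixed threshold \<open>M\<close> there are infinitely many \<open>n\<close> with \<open>f n M\<close> close to 1, so the \<open>k\<close>-th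
  index can be picked beyond the previous one for the threshold \<open>k + 1\<close>.
\<close>

lemma limsup_eq_one_diagonal:
  fixes f :: "nat \<Rightarrow> real \<Rightarrow> real"
  assumes le: "\<And>n M. f n M \<le> 1"
    and lim: "\<And>M. 0 < M \<Longrightarrow> limsup (\<lambda>n. ereal (f n M)) = 1"
  obtains r where "strict_mono r" and "(\<lambda>k. f (r k) (real (Suc k))) \<longlonglongrightarrow> 1"
proof -
  have ex: "\<exists>n>N. 1 - 1 / real (Suc k) < f n (real (Suc k))" for k N
  proof -
    obtain s where s: "strict_mono s" and "(\<lambda>j. f (s j) (real (Suc k))) \<longlonglongrightarrow> 1"
      using limsup_eq_oneE[OF lim[of "real (Suc k)"]] by auto
    then have "eventually (\<lambda>j. 1 - 1 / real (Suc k) < f (s j) (real (Suc k))) sequentially"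
      by (intro order_tendstoD(1)) auto
    moreover have "eventually (\<lambda>j. N < s j) sequentially"
      by (rule eventually_compose_filterlim[OF eventually_gt_at_top filterlim_subseq[OF s]])
    ultimately have "\<exists>j. 1 - 1 / real (Suc k) < f (s j) (real (Suc k)) \<and> N < s j"
      using eventually_happens[OF eventually_conj] by fastforce
    then show ?thesis by blast
  qed
  have "\<exists>r. \<forall>k. 1 - 1 / real (Suc k) < f (r k) (real (Suc k)) \<and> r k < r (Suc k)"
    using ex by (intro dependent_nat_choice) blast+
  then obtain r where r: "\<And>k. 1 - 1 / real (Suc k) < f (r k) (real (Suc k))" "\<And>k. r k < r (Suc k)"
    by blast
  have "(\<lambda>k. 1 - 1 / real (Suc k)) \<longlonglongrightarrow> 1 - 0"
    by (intro tendsto_diff tendsto_const lim_1_over_n[THEN LIMSEQ_Suc])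
  then have low: "(\<lambda>k. 1 - 1 / real (Suc k)) \<longlonglongrightarrow> 1"
    by simp
  have "(\<lambda>k. f (r k) (real (Suc k))) \<longlonglongrightarrow> 1"
    by (rule tendsto_sandwich[OF always_eventually always_eventually low tendsto_const])
      (intro allI less_imp_le[OF r(1)] le)+
  with r(2) show thesis
    by (intro that[of r]) (simp_all add: strict_mono_Suc_iff del: of_nat_Suc)
qed

section \<open>Estimates in a single market\<close>

lemma
  assumes "is_market m"
  shows market_prob_space: "prob_space (Prob m)"
    and market_zero_time: "0 \<in> times m"
    and market_horizon_time: "horizon m \<in> times m"
    and market_horizon_nonneg: "0 \<le> horizon m"
  using assms by (force simp: is_market_def time_set_def)+

lemma adapted_horizon_measurable:
  assumes "is_market m" and "adapted (times m) (filt m) X"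
  shows "X (horizon m) \<in> borel_measurable (Prob m)"
  using assms market_horizon_time[OF assms(1)]
  by (auto simp: adapted_def is_market_def filtration_on_def intro: measurable_from_subalg)

lemma wealth_horizon_measurable:
  assumes "is_market m" and "X \<in> wealth m"
  shows "X (horizon m) \<in> borel_measurable (Prob m)"
  using assms by (auto simp: is_market_def intro!: adapted_horizon_measurable)

lemma prob_ge_le_1:
  assumes "is_market m"
  shows "prob_ge m X M \<le> 1"
  using market_prob_space[OF assms] by (simp add: prob_ge_def prob_space.prob_le_1)

text \<open>
  The expectation of the conditional expectation given the initial \<open>\<sigma>\<close>-algebra is that of
  the terminal value.
\<close>

lemma supermartingale_terminal_le:
  assumes m: "is_market m"
    and S: "supermartingale (Prob m) (times m) (filt m) S"
    and init: "AE \<omega> in Prob m. S 0 \<omega> = x"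
  shows "integrable (Prob m) (S (horizon m))" and "(\<integral>\<omega>. S (horizon m) \<omega> \<partial>Prob m) \<le> x"
proof -
  interpret prob_space "Prob m" by (rule market_prob_space[OF m])
  note I = market_zero_time[OF m] market_horizon_time[OF m] market_horizon_nonneg[OF m]
  interpret finite_measure_subalgebra "Prob m" "filt m 0"
    by unfold_locales (use m I in \<open>simp add: is_market_def filtration_on_def\<close>)
  show int: "integrable (Prob m) (S (horizon m))"
    using S I by (simp add: supermartingale_def)
  have int0: "integrable (Prob m) (S 0)"
    using S I by (simp add: supermartingale_def)
  have "(\<integral>\<omega>. S (horizon m) \<omega> \<partial>Prob m)
      = (\<integral>\<omega>. real_cond_exp (Prob m) (filt m 0) (S (horizon m)) \<omega> \<partial>Prob m)"
    by (rule real_cond_exp_int(2)[OF int, symmetric])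
  also have "\<dots> \<le> (\<integral>\<omega>. S 0 \<omega> \<partial>Prob m)"
    by (rule integral_mono_AE[OF real_cond_exp_int(1)[OF int] int0])
      (use S I in \<open>simp add: supermartingale_def\<close>)
  also have "\<dots> = (\<integral>\<omega>. x \<partial>Prob m)"
    by (rule integral_cong_AE) (use int0 init in auto)
  finally show "(\<integral>\<omega>. S (horizon m) \<omega> \<partial>Prob m) \<le> x"
    by (simp add: prob_space)
qed

text \<open>
  If \<open>X\<^sub>T \<ge> 1\<close> but \<open>V\<^sub>T < K\<close>, then \<open>X\<^sub>T / V\<^sub>T \<ge> 1 / K\<close>, which is unlikely because
  \<open>X\<^sub>T / V\<^sub>T\<close> has expectation at most \<open>x\<close>.
\<close>

lemma prob_ge_wealth_le_numeraire:
  assumes m: "is_market m" and V: "numeraire_portfolio m V"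
    and X: "X \<in> wealth m" and init: "AE \<omega> in Prob m. X 0 \<omega> = x" and K: "0 < K"
  shows "prob_ge m X 1 \<le> prob_ge m V K + K * x"
proof -
  interpret prob_space "Prob m" by (rule market_prob_space[OF m])
  define T where "T = horizon m"
  define S where "S = (\<lambda>t \<omega>. X t \<omega> / V t \<omega>)"
  have [measurable]: "X T \<in> borel_measurable (Prob m)" "V T \<in> borel_measurable (Prob m)"
    using X V wealth_horizon_measurable[OF m]
    by (auto simp: T_def numeraire_portfolio_def unit_wealth_def)
  have [measurable]: "S T \<in> borel_measurable (Prob m)"
    unfolding S_def by measurable
  have super: "supermartingale (Prob m) (times m) (filt m) S"
    using V X by (simp add: S_def numeraire_portfolio_def)
  have "AE \<omega> in Prob m. V 0 \<omega> = 1"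
    using V by (simp add: numeraire_portfolio_def unit_wealth_def)
  with init have "AE \<omega> in Prob m. S 0 \<omega> = x"
    by eventually_elim (simp add: S_def)
  note S = supermartingale_terminal_le[OF m super this, folded T_def]
  have VT: "AE \<omega> in Prob m. 0 < V T \<omega>"
    using V market_horizon_time[OF m] by (simp add: numeraire_portfolio_def T_def)
  have XT: "AE \<omega> in Prob m. 0 \<le> X T \<omega>"
    using m X market_horizon_time[OF m] by (simp add: is_market_def T_def)
  have "AE \<omega> in Prob m. 0 \<le> S T \<omega>"
    using VT XT by eventually_elim (simp add: S_def)
  then have "prob {\<omega> \<in> space (Prob m). 1 / K \<le> S T \<omega>} \<le> (\<integral>\<omega>. S T \<omega> \<partial>Prob m) / (1 / K)"
    by (intro integral_Markov_inequality_measure[OF S(1) sets.empty_sets]) (use K in auto)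
  also have "\<dots> \<le> K * x"
    using S(2) K by (simp add: mult.commute)
  finally have markov: "prob {\<omega> \<in> space (Prob m). 1 / K \<le> S T \<omega>} \<le> K * x" .
  have "prob {\<omega> \<in> space (Prob m). 1 \<le> X T \<omega>}
      \<le> prob ({\<omega> \<in> space (Prob m). K \<le> V T \<omega>} \<union> {\<omega> \<in> space (Prob m). 1 / K \<le> S T \<omega>})"
  proof (rule finite_measure_mono_AE)
    show "AE \<omega> in Prob m. \<omega> \<in> {\<omega> \<in> space (Prob m). 1 \<le> X T \<omega>} \<longrightarrow>
        \<omega> \<in> {\<omega> \<in> space (Prob m). K \<le> V T \<omega>} \<union> {\<omega> \<in> space (Prob m). 1 / K \<le> S T \<omega>}"
      using VT
    proof eventually_elim
      case (elim \<omega>)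
      have "1 / K \<le> X T \<omega> / V T \<omega>" if "1 \<le> X T \<omega>" "V T \<omega> < K"
        using that elim by (intro frac_le) auto
      then show ?case by (cases "V T \<omega> < K") (auto simp: S_def)
    qed
  qed measurable
  also have "\<dots> \<le> prob {\<omega> \<in> space (Prob m). K \<le> V T \<omega>} + prob {\<omega> \<in> space (Prob m). 1 / K \<le> S T \<omega>}"
    by (rule measure_Un_le) measurable
  finally show ?thesis
    using markov by (simp add: prob_ge_def T_def)
qed

text \<open>
  On \<open>{V\<^sub>T \<ge> K}\<close> the weight \<open>Z\<^sub>T\<close> is at most \<open>V\<^sub>T Z\<^sub>T / K\<close>, whose expectation is at most
  \<open>1 / K\<close> because \<open>V Z\<close> is a supermartingale started at 1.
\<close>

lemma density_weight_numeraire_ge: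
  assumes m: "is_market m" and V: "numeraire_portfolio m V"
    and Z: "Z \<in> supermartingale_densities m" and K: "0 < K"
  shows "emeasure (weighted_measure (Z (horizon m)) (Prob m))
      {\<omega> \<in> space (Prob m). K \<le> V (horizon m) \<omega>} \<le> ennreal (1 / K)"
proof -
  interpret prob_space "Prob m" by (rule market_prob_space[OF m])
  define T where "T = horizon m"
  define S where "S = (\<lambda>t \<omega>. V t \<omega> * Z t \<omega>)"
  define A where "A = {\<omega> \<in> space (Prob m). K \<le> V T \<omega>}"
  have [measurable]: "V T \<in> borel_measurable (Prob m)"
    using V wealth_horizon_measurable[OF m]
    by (auto simp: T_def numeraire_portfolio_def unit_wealth_def)
  have [measurable]: "Z T \<in> borel_measurable (Prob m)"
    using Z adapted_horizon_measurable[OF m] by (simp add: T_def supermartingale_densities_def)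
  have [measurable]: "A \<in> sets (Prob m)"
    unfolding A_def by measurable
  have super: "supermartingale (Prob m) (times m) (filt m) S"
    using V Z by (simp add: S_def numeraire_portfolio_def unit_wealth_def supermartingale_densities_def)
  have "AE \<omega> in Prob m. V 0 \<omega> = 1" "AE \<omega> in Prob m. Z 0 \<omega> = 1"
    using V Z by (simp_all add: numeraire_portfolio_def unit_wealth_def supermartingale_densities_def)
  then have "AE \<omega> in Prob m. S 0 \<omega> = 1"
    by eventually_elim (simp add: S_def)
  note S = supermartingale_terminal_le[OF m super this, folded T_def]
  have pos: "AE \<omega> in Prob m. 0 < V T \<omega>" "AE \<omega> in Prob m. 0 < Z T \<omega>"
    using V Z market_horizon_time[OF m]
    by (simp_all add: numeraire_portfolio_def supermartingale_densities_def T_def)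
  have "emeasure (weighted_measure (Z T) (Prob m)) A
      = (\<integral>\<^sup>+\<omega>. ennreal (Z T \<omega>) * indicator A \<omega> \<partial>Prob m)"
    unfolding weighted_measure_def by (rule emeasure_density) measurable
  also have "\<dots> \<le> (\<integral>\<^sup>+\<omega>. ennreal (S T \<omega> / K) \<partial>Prob m)"
  proof (rule nn_integral_mono_AE)
    show "AE \<omega> in Prob m. ennreal (Z T \<omega>) * indicator A \<omega> \<le> ennreal (S T \<omega> / K)"
      using pos
    proof eventually_elim
      case (elim \<omega>)
      have "Z T \<omega> \<le> S T \<omega> / K" if "K \<le> V T \<omega>"
        using that elim K by (simp add: S_def pos_le_divide_eq mult.commute)
      then show ?case
        by (auto simp: A_def intro!: ennreal_leI split: split_indicator)
    qed
  qed
  also have "\<dots> = ennreal (\<integral>\<omega>. S T \<omega> / K \<partial>Prob m)"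
  proof (rule nn_integral_eq_integral)
    show "AE \<omega> in Prob m. 0 \<le> S T \<omega> / K"
      using pos by eventually_elim (use K in \<open>simp add: S_def\<close>)
  qed (use S(1) in simp)
  also have "\<dots> \<le> ennreal (1 / K)"
    using S(2) K by (intro ennreal_leI) (simp add: divide_right_mono)
  finally show ?thesis
    by (simp add: A_def T_def)
qed

text \<open>
  This makes \<open>V\<^sub>T\<inverse> \<cdot> P\<close> one of the measures considered in (e), so (e) specialises to (d).
\<close>

lemma inverse_numeraire_density:
  assumes m: "is_market m" and V: "numeraire_portfolio m V"
  shows "(\<lambda>t \<omega>. inverse (V t \<omega>)) \<in> supermartingale_densities m"
proof -
  have V1: "V \<in> wealth m" "AE \<omega> in Prob m. V 0 \<omega> = 1"
    using V by (simp_all add: numeraire_portfolio_def unit_wealth_def)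
  then have "adapted (times m) (filt m) V"
    using m by (simp add: is_market_def)
  then have "adapted (times m) (filt m) (\<lambda>t \<omega>. inverse (V t \<omega>))"
    by (auto simp: adapted_def)
  moreover have "AE \<omega> in Prob m. inverse (V 0 \<omega>) = 1"
    using V1(2) by eventually_elim simp
  ultimately show ?thesis
    using V by (simp add: supermartingale_densities_def numeraire_portfolio_def divide_inverse)
qed

text \<open>
  Off \<open>{V\<^sub>T \<ge> M}\<close> one has \<open>1 \<le> M / V\<^sub>T\<close>, so the part of \<open>A\<close> lying there has probability
  at most \<open>M\<close> times the weighted mass of \<open>A\<close>.
\<close>

lemma prob_le_prob_ge_numeraire:
  assumes m: "is_market m" and V: "numeraire_portfolio m V"
    and A[measurable]: "A \<in> sets (Prob m)" and M: "0 < M"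
  shows "emeasure (Prob m) A \<le> ennreal (prob_ge m V M) + ennreal M *
      emeasure (weighted_measure (\<lambda>\<omega>. inverse (V (horizon m) \<omega>)) (Prob m)) A"
proof -
  interpret prob_space "Prob m" by (rule market_prob_space[OF m])
  define T where "T = horizon m"
  define B where "B = {\<omega> \<in> space (Prob m). M \<le> V T \<omega>}"
  have [measurable]: "V T \<in> borel_measurable (Prob m)"
    using V wealth_horizon_measurable[OF m]
    by (auto simp: T_def numeraire_portfolio_def unit_wealth_def)
  have [measurable]: "B \<in> sets (Prob m)"
    unfolding B_def by measurable
  have pos: "AE \<omega> in Prob m. 0 < V T \<omega>"
    using V market_horizon_time[OF m] by (simp add: numeraire_portfolio_def T_def)
  have "emeasure (Prob m) A = (\<integral>\<^sup>+\<omega>. indicator A \<omega> \<partial>Prob m)"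
    by simp
  also have "\<dots> \<le> (\<integral>\<^sup>+\<omega>. indicator B \<omega> +
      ennreal M * (ennreal (inverse (V T \<omega>)) * indicator A \<omega>) \<partial>Prob m)"
  proof (rule nn_integral_mono_AE)
    show "AE \<omega> in Prob m. indicator A \<omega> \<le> indicator B \<omega> +
        ennreal M * (ennreal (inverse (V T \<omega>)) * indicator A \<omega>)"
      using pos AE_space
    proof eventually_elim
      case (elim \<omega>)
      have "1 \<le> ennreal M * ennreal (inverse (V T \<omega>))" if "V T \<omega> < M"
      proof -
        have "1 \<le> M * inverse (V T \<omega>)"
          using that elim by (simp add: field_simps)
        then show ?thesis
          using M elim by (simp flip: ennreal_mult)
      qed
      with elim show ?case
        by (cases "V T \<omega> < M") (auto simp: B_def not_less split: split_indicator)
    qed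
  qed
  also have "\<dots> = emeasure (Prob m) B +
      ennreal M * emeasure (weighted_measure (\<lambda>\<omega>. inverse (V T \<omega>)) (Prob m)) A"
    unfolding weighted_measure_def
    by (subst emeasure_density) (simp_all add: nn_integral_add nn_integral_cmult)
  finally show ?thesis
    by (simp add: emeasure_eq_measure prob_ge_def B_def T_def)
qed

section \<open>The five conditions\<close>

lemma SAA_imp_numeraire_explodes:
  assumes m: "\<And>n. is_market (m n)" and V: "\<And>n. numeraire_portfolio (m n) (V n)"
    and "SAA m" and M: "0 < M"
  shows "limsup (\<lambda>n. ereal (prob_ge (m n) (V n) M)) = 1"
proof -
  obtain X x where X: "\<And>n. X n \<in> wealth (m n)" "\<And>n. AE \<omega> in Prob (m n). X n 0 \<omega> = x n"
    and x: "x \<longlonglongrightarrow> 0" and lim_X: "limsup (\<lambda>n. ereal (prob_ge (m n) (X n) 1)) = 1"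
    using \<open>SAA m\<close> by (auto simp: SAA_def)
  obtain r where r: "strict_mono r" and
    lim: "(\<lambda>k. prob_ge (m (r k)) (X (r k)) 1) \<longlonglongrightarrow> 1"
    by (rule limsup_eq_oneE[OF lim_X])
  have "(\<lambda>k. x (r k)) \<longlonglongrightarrow> 0"
    using LIMSEQ_subseq_LIMSEQ[OF x r] by (simp add: comp_def)
  then have "(\<lambda>k. prob_ge (m (r k)) (X (r k)) 1 - M * x (r k)) \<longlonglongrightarrow> 1 - M * 0"
    by (intro tendsto_diff lim tendsto_mult tendsto_const)
  then have low: "(\<lambda>k. prob_ge (m (r k)) (X (r k)) 1 - M * x (r k)) \<longlonglongrightarrow> 1"
    by simp
  have "prob_ge (m n) (X n) 1 - M * x n \<le> prob_ge (m n) (V n) M" for n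
    using prob_ge_wealth_le_numeraire[OF m V X M] by (simp add: diff_le_eq)
  then have "(\<lambda>k. prob_ge (m (r k)) (V (r k)) M) \<longlonglongrightarrow> 1"
    by (intro tendsto_sandwich[OF _ _ low tendsto_const] always_eventually)
      (auto simp: prob_ge_le_1[OF m])
  then show ?thesis
    by (intro limsup_eq_oneI[OF _ r]) (simp_all add: prob_ge_le_1[OF m])
qed

text \<open>
  Dividing \<open>Y n\<close> by \<open>c n\<close> turns the level \<open>c n\<close> into the level 1 and the initial capital 1 into
  \<open>1 / c n\<close>. The initial capital must vanish along the whole sequence of markets, the
  probability of success need only tend to one along a subsequence.
\<close>

lemma unit_wealth_explodes_imp_SAA:
  assumes m: "\<And>n. is_market (m n)" and Y: "\<And>n. Y n \<in> unit_wealth (m n)"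
    and lim: "\<And>M. 0 < M \<Longrightarrow> limsup (\<lambda>n. ereal (prob_ge (m n) (Y n) M)) = 1"
  shows "SAA m"
proof -
  obtain r where r: "strict_mono r"
    and lim_r: "(\<lambda>k. prob_ge (m (r k)) (Y (r k)) (real (Suc k))) \<longlonglongrightarrow> 1"
    by (rule limsup_eq_one_diagonal[of "\<lambda>n. prob_ge (m n) (Y n)", OF prob_ge_le_1[OF m] lim])
  \<comment> \<open>A rate defined at every index which tends to infinity and equals \<open>k + 1\<close> at \<open>r k\<close>.\<close>
  define c where "c n = real (Suc (LEAST k. n \<le> r k))" for n
  have c_pos: "0 < c n" for n
    by (simp add: c_def)
  have c_r: "c (r k) = real (Suc k)" for k
  proof -
    have "(LEAST j. r k \<le> r j) = k"
      by (rule Least_equality) (simp_all add: strict_mono_less_eq[OF r])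
    then show ?thesis by (simp add: c_def)
  qed
  have "filterlim (\<lambda>n. LEAST k. n \<le> r k) at_top sequentially"
    unfolding filterlim_at_top
  proof
    fix N
    have "N \<le> (LEAST k. n \<le> r k)" if "r N \<le> n" for n
    proof -
      have "n \<le> r (LEAST k. n \<le> r k)"
        by (rule LeastI[of _ n]) (rule strict_mono_imp_increasing[OF r])
      with that have "r N \<le> r (LEAST k. n \<le> r k)"
        by simp
      then show ?thesis
        by (simp add: strict_mono_less_eq[OF r])
    qed
    then show "eventually (\<lambda>n. N \<le> (LEAST k. n \<le> r k)) sequentially"
      by (auto simp: eventually_sequentially)
  qed
  then have "filterlim (\<lambda>n. Suc (LEAST k. n \<le> r k)) at_top sequentially"
    by (rule filterlim_compose[OF filterlim_Suc])
  then have "filterlim c at_top sequentially"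
    unfolding c_def by (rule filterlim_compose[OF filterlim_real_sequentially])
  then have c_lim: "(\<lambda>n. 1 / c n) \<longlonglongrightarrow> 0"
    by (intro real_tendsto_divide_at_top[OF tendsto_const])
  define X where "X n = (\<lambda>t \<omega>. 1 / c n * Y n t \<omega>)" for n
  have ge: "prob_ge (m n) (X n) 1 = prob_ge (m n) (Y n) (c n)" for n
    using c_pos[of n] by (simp add: prob_ge_def X_def pos_le_divide_eq)
  have X_wealth: "X n \<in> wealth (m n)" for n
  proof -
    have "\<forall>X\<in>wealth (m n). \<forall>a>0. (\<lambda>t \<omega>. a * X t \<omega>) \<in> wealth (m n)"
      using m[of n] by (simp add: is_market_def)
    moreover have "Y n \<in> wealth (m n)"
      using Y[of n] by (simp add: unit_wealth_def)
    ultimately show ?thesis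
      using c_pos[of n] unfolding X_def by (simp del: times_divide_eq_left)
  qed
  have X_init: "AE \<omega> in Prob (m n). X n 0 \<omega> = 1 / c n" for n
  proof -
    have "AE \<omega> in Prob (m n). Y n 0 \<omega> = 1"
      using Y[of n] by (simp add: unit_wealth_def)
    then show ?thesis
      by eventually_elim (simp add: X_def)
  qed
  have X_lim: "limsup (\<lambda>n. ereal (prob_ge (m n) (X n) 1)) = 1"
    by (rule limsup_eq_oneI[OF _ r]) (simp_all add: prob_ge_le_1[OF m] ge c_r lim_r del: of_nat_Suc)
  show ?thesis
    unfolding SAA_def
    by (intro exI[of _ X] exI[of _ "\<lambda>n. 1 / c n"] conjI allI X_wealth X_init c_lim X_lim)
qed

text \<open>
  One choice of separating events, \<open>{V\<^sub>T \<ge> k + 1}\<close> in the \<open>k\<close>-th market of the subsequence,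
  serves all density sequences at once.
\<close>

lemma numeraire_explodes_imp_separated:
  assumes m: "\<And>n. is_market (m n)" and V: "\<And>n. numeraire_portfolio (m n) (V n)"
    and lim: "\<And>M. 0 < M \<Longrightarrow> limsup (\<lambda>n. ereal (prob_ge (m n) (V n) M)) = 1"
    and Z: "\<And>n. Z n \<in> supermartingale_densities (m n)"
  shows "entirely_separated (\<lambda>n. Prob (m n))
    (\<lambda>n. weighted_measure (Z n (horizon (m n))) (Prob (m n)))"
proof -
  obtain r where r: "strict_mono r"
    and lim_r: "(\<lambda>k. prob_ge (m (r k)) (V (r k)) (real (Suc k))) \<longlonglongrightarrow> 1"
    by (rule limsup_eq_one_diagonal[of "\<lambda>n. prob_ge (m n) (V n)", OF prob_ge_le_1[OF m] lim])
  define A where "A k = {\<omega> \<in> space (Prob (m (r k))).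
      real (Suc k) \<le> V (r k) (horizon (m (r k))) \<omega>}" for k
  have "V n (horizon (m n)) \<in> borel_measurable (Prob (m n))" for n
    using V[of n] wealth_horizon_measurable[OF m]
    by (simp add: numeraire_portfolio_def unit_wealth_def)
  then have sets: "A k \<in> sets (Prob (m (r k)))" for k
    unfolding A_def by measurable
  have "emeasure (Prob (m n)) B = ennreal (measure (Prob (m n)) B)" for n B
    using market_prob_space[OF m]
    by (simp add: finite_measure.emeasure_eq_measure prob_space_def)
  then have "emeasure (Prob (m (r k))) (A k)
      = ennreal (prob_ge (m (r k)) (V (r k)) (real (Suc k)))" for k
    by (simp add: A_def prob_ge_def)
  moreover have "(\<lambda>k. ennreal (prob_ge (m (r k)) (V (r k)) (real (Suc k)))) \<longlonglongrightarrow> ennreal 1"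
    by (rule tendsto_ennrealI[OF lim_r])
  ultimately have P: "(\<lambda>k. emeasure (Prob (m (r k))) (A k)) \<longlonglongrightarrow> 1"
    by simp
  have "(\<lambda>k. 1 / real (Suc k)) \<longlonglongrightarrow> 0"
    by (rule lim_1_over_n[THEN LIMSEQ_Suc])
  then have "(\<lambda>k. ennreal (1 / real (Suc k))) \<longlonglongrightarrow> ennreal 0"
    by (rule tendsto_ennrealI)
  then have "(\<lambda>k. ennreal (1 / real (Suc k))) \<longlonglongrightarrow> 0"
    by simp
  then have Q: "(\<lambda>k. emeasure (weighted_measure (Z (r k) (horizon (m (r k)))) (Prob (m (r k)))) (A k))
      \<longlonglongrightarrow> 0"
    by (rule tendsto_sandwich[OF _ _ tendsto_const, rotated 2])
      (use density_weight_numeraire_ge[OF m V Z] in \<open>auto simp: A_def intro!: always_eventually\<close>)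
  show ?thesis
    unfolding entirely_separated_def
    by (intro exI[of _ r] exI[of _ A] conjI allI r sets P Q)
qed

lemma separated_imp_numeraire_explodes:
  assumes m: "\<And>n. is_market (m n)" and V: "\<And>n. numeraire_portfolio (m n) (V n)"
    and sep: "entirely_separated (\<lambda>n. Prob (m n))
      (\<lambda>n. weighted_measure (\<lambda>\<omega>. inverse (V n (horizon (m n)) \<omega>)) (Prob (m n)))"
    and M: "0 < M"
  shows "limsup (\<lambda>n. ereal (prob_ge (m n) (V n) M)) = 1"
proof -
  define Q where "Q n = weighted_measure (\<lambda>\<omega>. inverse (V n (horizon (m n)) \<omega>)) (Prob (m n))" for n
  obtain r A where r: "strict_mono r" and A: "\<And>k. A k \<in> sets (Prob (m (r k)))"
    and P_lim: "(\<lambda>k. emeasure (Prob (m (r k))) (A k)) \<longlonglongrightarrow> 1"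
    and Q_lim: "(\<lambda>k. emeasure (Q (r k)) (A k)) \<longlonglongrightarrow> 0"
    using sep unfolding entirely_separated_def Q_def by blast
  have "(\<lambda>k. ennreal M * emeasure (Q (r k)) (A k)) \<longlonglongrightarrow> ennreal M * 0"
    by (rule ennreal_tendsto_cmult[OF _ Q_lim]) simp
  then have "(\<lambda>k. emeasure (Prob (m (r k))) (A k) - ennreal M * emeasure (Q (r k)) (A k))
      \<longlonglongrightarrow> 1 - 0"
    by (intro tendsto_diff_ennreal P_lim) simp_all
  then have low: "(\<lambda>k. emeasure (Prob (m (r k))) (A k) - ennreal M * emeasure (Q (r k)) (A k))
      \<longlonglongrightarrow> 1"
    by simp
  have "emeasure (Prob (m (r k))) (A k) - ennreal M * emeasure (Q (r k)) (A k)
      \<le> ennreal (prob_ge (m (r k)) (V (r k)) M)" for k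
    using prob_le_prob_ge_numeraire[OF m V A M, of k]
      prob_space.emeasure_le_1[OF market_prob_space[OF m], of "r k" "A k"]
    by (auto simp: Q_def ennreal_minus_le_iff add.commute top_unique)
  then have "(\<lambda>k. ennreal (prob_ge (m (r k)) (V (r k)) M)) \<longlonglongrightarrow> 1"
    by (intro tendsto_sandwich[OF _ _ low tendsto_const] always_eventually)
      (auto simp: prob_ge_le_1[OF m])
  then have "(\<lambda>k. ennreal (prob_ge (m (r k)) (V (r k)) M)) \<longlonglongrightarrow> ennreal 1"
    by simp
  then have "(\<lambda>k. prob_ge (m (r k)) (V (r k)) M) \<longlonglongrightarrow> 1"
    by (subst (asm) tendsto_ennreal_iff) (simp_all add: prob_ge_def)
  then show ?thesis
    by (intro limsup_eq_oneI[OF _ r]) (simp_all add: prob_ge_le_1[OF m])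
qed

theorem theorem2p2:
  fixes m :: "nat \<Rightarrow> 'a market"
    and V :: "nat \<Rightarrow> real \<Rightarrow> 'a \<Rightarrow> real"
  assumes "\<And>n. is_market (m n)"
    and "\<And>n. numeraire_portfolio (m n) (V n)"
  defines "a \<equiv> SAA m"
    and "b \<equiv> (\<exists>Y. (\<forall>n. Y n \<in> unit_wealth (m n)) \<and>
                (\<forall>M>0. limsup (\<lambda>n. ereal (prob_ge (m n) (Y n) M)) = 1))"
    and "c \<equiv> (\<forall>M>0. limsup (\<lambda>n. ereal (prob_ge (m n) (V n) M)) = 1)"
    and "d \<equiv> entirely_separated (\<lambda>n. Prob (m n))
           (\<lambda>n. weighted_measure (\<lambda>\<omega>. inverse (V n (horizon (m n)) \<omega>)) (Prob (m n)))"
    and "e \<equiv> (\<forall>Z. (\<forall>n. Z n \<in> supermartingale_densities (m n)) \<longrightarrow>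
           entirely_separated (\<lambda>n. Prob (m n))
             (\<lambda>n. weighted_measure (Z n (horizon (m n))) (Prob (m n))))"
  shows "(a \<longleftrightarrow> b) \<and> (b \<longleftrightarrow> c) \<and> (c \<longleftrightarrow> d) \<and> (d \<longleftrightarrow> e)"
proof -
  note m = assms(1) and V = assms(2)
  have "c" if "a"
    unfolding c_def using SAA_imp_numeraire_explodes[OF m V that[unfolded a_def]] by simp
  moreover have "b" if "c"
    unfolding b_def
  proof (intro exI conjI)
    show "\<forall>n. V n \<in> unit_wealth (m n)"
      using V by (simp add: numeraire_portfolio_def)
    show "\<forall>M>0. limsup (\<lambda>n. ereal (prob_ge (m n) (V n) M)) = 1"
      by (rule that[unfolded c_def])
  qed
  moreover have "a" if "b"
  proof -
    from that[unfolded b_def] obtain Y where Y: "\<forall>n. Y n \<in> unit_wealth (m n)"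
      and lim: "\<forall>M>0. limsup (\<lambda>n. ereal (prob_ge (m n) (Y n) M)) = 1"
      by (elim exE conjE)
    show ?thesis
      unfolding a_def
      by (rule unit_wealth_explodes_imp_SAA[OF m Y[rule_format] lim[rule_format]])
  qed
  moreover have "e" if "c"
    unfolding e_def
  proof (intro allI impI)
    fix Z assume Z: "\<forall>n. Z n \<in> supermartingale_densities (m n)"
    show "entirely_separated (\<lambda>n. Prob (m n))
        (\<lambda>n. weighted_measure (Z n (horizon (m n))) (Prob (m n)))"
      by (rule numeraire_explodes_imp_separated[OF m V that[unfolded c_def, rule_format] Z[rule_format]])
  qed
  moreover have "d" if "e"
  proof -
    have "\<forall>n. (\<lambda>t \<omega>. inverse (V n t \<omega>)) \<in> supermartingale_densities (m n)"
      using inverse_numeraire_density[OF m V] by simp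
    then show ?thesis
      unfolding d_def by (rule that[unfolded e_def, THEN spec, THEN mp])
  qed
  moreover have "c" if "d"
    unfolding c_def
  proof (intro allI impI)
    fix M :: real assume "0 < M"
    then show "limsup (\<lambda>n. ereal (prob_ge (m n) (V n) M)) = 1"
      by (rule separated_imp_numeraire_explodes[OF m V that[unfolded d_def]])
  qed
  ultimately show ?thesis
    by satx
qed

end
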